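(* Let $R$ be a commutative semiring that is zero-sum-free and integral. Let $X$ be a simplicial set and $Y$ a simplicial group. Then a simplicial distribution $p\in \mathrm{sSet}(X,D_R(Y))$ is noncontextual if and only if $p$ is weakly invertible in the $R$-convex monoid $\mathrm{sSet}(X,D_R(Y))$.
   Context: A semiring $R$ is zero-sum-free if $a+b=0$ implies $a=b=0$, and integral if $ab=0$ implies $a=0$ or $b=0$. For a set $S$, $D_R(S)$ is the set of functions $p:S\to R$ of finite support with $\sum_s p(s)=1$; for $f:S\to T$, $D_R(f)(p)(t)=\sum_{f(s)=t}p(s)$; $\delta^s$ is the delta distribution at $s$. For a simplicial set $Y$, $D_R(Y)$ is the simplicial set obtained by applying $D_R$ degreewise. A simplicial distribution on $(X,Y)$ is a simplicial map $p:X\to D_R(Y)$. The map $\Theta_{X,Y}:D_R(\mathrm{sSet}(X,Y))\to \mathrm{sSet}(X,D_R(Y))$ is $\Theta_{X,Y}(d)_n(x)=\sum_{\varphi\in\mathrm{sSet}(X,Y)}d(\varphi)\delta^{\varphi_n(x)}$. A simplicial distribution is noncontextual if it lies in the image of $\Theta_{X,Y}$. For $Y$ a simplicial group, $M=\mathrm{sSet}(X,D_R(Y))$ is a monoid under $(p\cdot q)_n(x)(y)=\sum_{y_1y_2=y}p_n(x)(y_1)\,q_n(x)(y_2)$ ($y_1,y_2\in Y_n$), with unit $x\mapsto\delta^{e}$, $e$ the identity of $Y_n$. It is an $R$-convex set via $\pi^M:D_R(M)\to M$, $\pi^M(Q)_n(x)=\sum_{p\in M}Q(p)\,p_n(x)$.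 Let $M^*\subseteq M$ be the group of invertible elements. An element $m\in M$ is weakly invertible if it is in the image of the composite $D_R(M^* )\hookrightarrow D_R(M)\xrightarrow{\pi^M}M$. *)

theory Defs
  imports "HOL-Algebra.Group" "HOL-Library.FuncSet"
begin

section \<open>Distributions with values in a commutative semiring\<close>

text \<open>
  The sort \<open>{comm_semiring_0, comm_monoid_mult}\<close> is that of commutative semirings with
  one; unlike \<open>comm_semiring_1\<close> it does not impose \<open>0 \<noteq> 1\<close>.

  A function \<open>S \<Rightarrow> R\<close> is represented by its extension by zero to the ambient type, so that
  \<open>distr S\<close> is a subset of \<open>distr T\<close> whenever \<open>S\<close> is a subset of \<open>T\<close>. Since a sum over an
  infinite set is \<open>0\<close> in HOL, all sums below range over (finite) supports only.
\<close>

definition distr :: "'s set \<Rightarrow> ('s \<Rightarrow> 'r::{comm_semiring_0,comm_monoid_mult}) set" where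
  "distr S = {p. finite {s. p s \<noteq> 0} \<and> {s. p s \<noteq> 0} \<subseteq> S \<and> (\<Sum>s | p s \<noteq> 0. p s) = 1}"

definition distr_map ::
    "('s \<Rightarrow> 't) \<Rightarrow> ('s \<Rightarrow> 'r::{comm_semiring_0,comm_monoid_mult}) \<Rightarrow> ('t \<Rightarrow> 'r)" where
  "distr_map f p = (\<lambda>t. \<Sum>s | p s \<noteq> 0 \<and> f s = t. p s)"

definition delta :: "'s \<Rightarrow> ('s \<Rightarrow> 'r::{comm_semiring_0,comm_monoid_mult})" where
  "delta s = (\<lambda>t. if t = s then 1 else 0)"

section \<open>Simplicial sets and simplicial groups\<close>

text \<open>
  The simplex category: the object \<open>[n]\<close> is \<open>{..n} = {0, \<dots>, n}\<close> and \<open>simplex_maps m n\<close> is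
  the set of order-preserving maps from \<open>[m]\<close> to \<open>[n]\<close>, made extensional so that it has one
  representative for each map.
\<close>

definition simplex_maps :: "nat \<Rightarrow> nat \<Rightarrow> (nat \<Rightarrow> nat) set" where
  "simplex_maps m n = {\<theta> \<in> {..m} \<rightarrow>\<^sub>E {..n}. mono_on {..m} \<theta>}"

text \<open>
  For \<open>\<theta> \<in> simplex_maps m n\<close>, the map \<open>act X m n \<theta>\<close> is the induced map from \<open>X\<^sub>n\<close> to \<open>X\<^sub>m\<close>.
\<close>

record 'a sset =
  simplices :: "nat \<Rightarrow> 'a set"
  act :: "nat \<Rightarrow> nat \<Rightarrow> (nat \<Rightarrow> nat) \<Rightarrow> 'a \<Rightarrow> 'a"

definition simplicial_set :: "('a, 'm) sset_scheme \<Rightarrow> bool" where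
  "simplicial_set X \<longleftrightarrow>
     (\<forall>m n. \<forall>\<theta> \<in> simplex_maps m n. act X m n \<theta> \<in> simplices X n \<rightarrow> simplices X m) \<and>
     (\<forall>n. \<forall>x \<in> simplices X n. act X n n (restrict id {..n}) x = x) \<and>
     (\<forall>k m n. \<forall>\<psi> \<in> simplex_maps k m. \<forall>\<theta> \<in> simplex_maps m n. \<forall>x \<in> simplices X n.
        act X k n (compose {..k} \<theta> \<psi>) x = act X k m \<psi> (act X m n \<theta> x))"

text \<open>
  The set of simplicial maps. Its elements are extensional in each degree, so that equality
  of simplicial maps is equality in HOL.
\<close>

definition sset_maps ::
    "('a, 'm) sset_scheme \<Rightarrow> ('b, 'n) sset_scheme \<Rightarrow> (nat \<Rightarrow> 'a \<Rightarrow> 'b) set" where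
  "sset_maps X Y =
     {\<phi>. (\<forall>n. \<phi> n \<in> simplices X n \<rightarrow>\<^sub>E simplices Y n) \<and>
          (\<forall>m n. \<forall>\<theta> \<in> simplex_maps m n. \<forall>x \<in> simplices X n.
             \<phi> m (act X m n \<theta> x) = act Y m n \<theta> (\<phi> n x))}"

record 'a sgroup = "'a sset" +
  smult :: "nat \<Rightarrow> 'a \<Rightarrow> 'a \<Rightarrow> 'a"
  sone :: "nat \<Rightarrow> 'a"

definition degree_group :: "('a, 'm) sgroup_scheme \<Rightarrow> nat \<Rightarrow> 'a monoid" where
  "degree_group Y n = \<lparr>carrier = simplices Y n, mult = smult Y n, one = sone Y n\<rparr>"

definition simplicial_group :: "('a, 'm) sgroup_scheme \<Rightarrow> bool" where
  "simplicial_group Y \<longleftrightarrow>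
     simplicial_set Y \<and>
     (\<forall>n. group (degree_group Y n)) \<and>
     (\<forall>m n. \<forall>\<theta> \<in> simplex_maps m n. act Y m n \<theta> \<in> hom (degree_group Y n) (degree_group Y m))"

section \<open>Simplicial distributions\<close>

definition distr_sset ::
    "('b, 'n) sset_scheme \<Rightarrow> ('b \<Rightarrow> 'r::{comm_semiring_0,comm_monoid_mult}) sset" where
  "distr_sset Y =
     \<lparr>simplices = (\<lambda>n. distr (simplices Y n)),
      act = (\<lambda>m n \<theta>. distr_map (act Y m n \<theta>))\<rparr>"

definition Theta ::
    "('a, 'm) sset_scheme \<Rightarrow> ('b, 'n) sset_scheme \<Rightarrow>
     ((nat \<Rightarrow> 'a \<Rightarrow> 'b) \<Rightarrow> 'r::{comm_semiring_0,comm_monoid_mult}) \<Rightarrow>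
     (nat \<Rightarrow> 'a \<Rightarrow> 'b \<Rightarrow> 'r)" where
  "Theta X Y d =
     (\<lambda>n. \<lambda>x\<in>simplices X n. \<lambda>y. \<Sum>\<phi> | \<phi> \<in> sset_maps X Y \<and> d \<phi> \<noteq> 0. d \<phi> * delta (\<phi> n x) y)"

definition noncontextual ::
    "('a, 'm) sset_scheme \<Rightarrow> ('b, 'n) sset_scheme \<Rightarrow>
     (nat \<Rightarrow> 'a \<Rightarrow> 'b \<Rightarrow> 'r::{comm_semiring_0,comm_monoid_mult}) \<Rightarrow> bool" where
  "noncontextual X Y p \<longleftrightarrow> p \<in> Theta X Y ` distr (sset_maps X Y)"

section \<open>The convex monoid of simplicial distributions\<close>

definition distr_monoid ::
    "('a, 'm) sset_scheme \<Rightarrow> ('b, 'n) sgroup_scheme \<Rightarrow>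
     (nat \<Rightarrow> 'a \<Rightarrow> 'b \<Rightarrow> 'r::{comm_semiring_0,comm_monoid_mult}) monoid" where
  "distr_monoid X Y =
     \<lparr>carrier = sset_maps X (distr_sset Y),
      mult = (\<lambda>p q n. \<lambda>x\<in>simplices X n. \<lambda>y.
        \<Sum>(y1, y2) | p n x y1 \<noteq> 0 \<and> q n x y2 \<noteq> 0 \<and> y1 \<otimes>\<^bsub>degree_group Y n\<^esub> y2 = y.
          p n x y1 * q n x y2),
      one = (\<lambda>n. \<lambda>x\<in>simplices X n. delta \<one>\<^bsub>degree_group Y n\<^esub>)\<rparr>"

definition convex_eval ::
    "('a, 'm) sset_scheme \<Rightarrow> ('b, 'n) sgroup_scheme \<Rightarrow>
     ((nat \<Rightarrow> 'a \<Rightarrow> 'b \<Rightarrow> 'r) \<Rightarrow> 'r::{comm_semiring_0,comm_monoid_mult}) \<Rightarrow>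
     (nat \<Rightarrow> 'a \<Rightarrow> 'b \<Rightarrow> 'r)" where
  "convex_eval X Y Q =
     (\<lambda>n. \<lambda>x\<in>simplices X n. \<lambda>y.
        \<Sum>p | p \<in> carrier (distr_monoid X Y) \<and> Q p \<noteq> 0. Q p * p n x y)"

text \<open>
  Weak invertibility in a monoid \<open>M\<close> with convex structure map \<open>\<pi>\<close>. The inclusion of
  \<open>distr (Units M)\<close> into \<open>distr (carrier M)\<close> is a set inclusion.
\<close>

definition weakly_invertible ::
    "('c, 'k) monoid_scheme \<Rightarrow>
     (('c \<Rightarrow> 'r::{comm_semiring_0,comm_monoid_mult}) \<Rightarrow> 'c) \<Rightarrow> 'c \<Rightarrow> bool" where
  "weakly_invertible M \<pi> m \<longleftrightarrow> m \<in> \<pi> ` distr (Units M)"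

end

theory Submission imports Defs begin

text \<open>
  If \<open>1 \<noteq> 0\<close>, zero-sum-freeness and integrality make the support of a convolution the product
  of the supports, so if a convolution is \<open>\<delta>\<^sup>e\<close> then both factors are delta distributions.
  Hence the units of the monoid of simplicial distributions are exactly the maps
  \<open>x \<mapsto> \<delta>\<close> at \<open>\<phi>(x)\<close> for simplicial maps \<open>\<phi>\<close>. Under this identification
  \<open>\<Theta>\<close> is the restriction of the convex structure map to distributions on units.
\<close>

section \<open>Distributions with values in a semiring\<close>

lemma sum_eq_0_zero_sum_free:
  fixes f :: "'s \<Rightarrow> 'r::comm_monoid_add"
  assumes zero_sum_free: "\<forall>a b :: 'r. a + b = 0 \<longrightarrow> a = 0 \<and> b = 0"
    and "finite A" "sum f A = 0" "x \<in> A"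
  shows "f x = 0"
  using assms(2-4)
proof (induction A rule: finite_induct)
  case (insert z A)
  then have "f z + sum f A = 0" by simp
  with zero_sum_free have "f z = 0" "sum f A = 0" by blast+
  with insert.IH insert.prems show ?case by blast
qed simp

lemma supp_delta:
  assumes "(1::'r::{comm_semiring_0,comm_monoid_mult}) \<noteq> 0"
  shows "{t. delta s t \<noteq> (0::'r)} = {s}"
  using assms by (auto simp: delta_def)

lemma delta_in_distr:
  assumes "(1::'r::{comm_semiring_0,comm_monoid_mult}) \<noteq> 0" "s \<in> S"
  shows "(delta s :: 's \<Rightarrow> 'r) \<in> distr S"
  using assms(2) by (simp add: distr_def supp_delta[OF assms(1)]) (simp add: delta_def)

lemma delta_eq_iff:
  assumes "(1::'r::{comm_semiring_0,comm_monoid_mult}) \<noteq> 0"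
  shows "(delta s :: 's \<Rightarrow> 'r) = delta t \<longleftrightarrow> s = t"
  using assms by (metis delta_def)

lemma distr_map_delta:
  assumes "(1::'r::{comm_semiring_0,comm_monoid_mult}) \<noteq> 0"
  shows "distr_map f (delta s :: 's \<Rightarrow> 'r) = delta (f s)"
proof
  fix t
  have "{u. (delta s u :: 'r) \<noteq> 0 \<and> f u = t} = (if f s = t then {s} else {})"
    using assms by (auto simp: delta_def)
  then show "distr_map f (delta s :: 's \<Rightarrow> 'r) t = delta (f s) t"
    by (auto simp: distr_map_def delta_def)
qed

lemma distr_singleton:
  assumes "p \<in> distr S" "{s. p s \<noteq> 0} = {s}"
  shows "p = delta s"
proof -
  have "p s = 1" using assms by (simp add: distr_def)
  then show ?thesis using assms(2) by (auto simp: delta_def fun_eq_iff)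
qed

text \<open>The sort admits the zero ring, where every element is 0. The only function is then the
  zero function, and it counts as a distribution because its empty sum 0 equals 1.\<close>

lemma distr_trivial:
  assumes "(1::'r::{comm_semiring_0,comm_monoid_mult}) = 0"
  shows "distr S = {\<lambda>_. 0 :: 'r}"
proof -
  have zero: "a = 0" for a :: 'r
    using assms by (metis mult_1 mult_zero_left)
  have "p = (\<lambda>_. 0)" for p :: "'s \<Rightarrow> 'r"
    by (rule ext) (rule zero)
  moreover have "(\<lambda>_. 0 :: 'r) \<in> distr S"
    using assms by (simp add: distr_def)
  ultimately show ?thesis by blast
qed

text \<open>The products of a support point of \<open>a\<close> with a support point of
  \<open>b\<close> can only hit the identity, so a single support point of \<open>b\<close> already
  determines every support point of \<open>a\<close> as its inverse. The case \<open_free> does not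
  arise: both supports are nonempty because 1 \<noteq> 0.\<close>

lemma convolution_eq_delta_one:
  fixes G (structure) and a b :: "'g \<Rightarrow> 'r::{comm_semiring_0,comm_monoid_mult}"
  assumes zero_sum_free: "\<forall>a b :: 'r. a + b = 0 \<longrightarrow> a = 0 \<and> b = 0"
    and integral: "\<forall>a b :: 'r. a * b = 0 \<longrightarrow> a = 0 \<or> b = 0"
    and one_neq_zero: "(1::'r) \<noteq> 0"
    and G: "group G"
    and a: "a \<in> distr (carrier G)" and b: "b \<in> distr (carrier G)"
    and conv: "(\<lambda>y. \<Sum>(y1, y2) | a y1 \<noteq> 0 \<and> b y2 \<noteq> 0 \<and> y1 \<otimes>\<^bsub>G\<^esub> y2 = y. a y1 * b y2)
      = delta \<one>\<^bsub>G\<^esub>"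
  obtains g where "g \<in> carrier G" "a = delta g"
proof -
  interpret group G by fact
  have fin: "finite {y. a y \<noteq> 0}" "finite {y. b y \<noteq> 0}"
    and carr: "\<And>y. a y \<noteq> 0 \<Longrightarrow> y \<in> carrier G" "\<And>y. b y \<noteq> 0 \<Longrightarrow> y \<in> carrier G"
    using a b by (auto simp: distr_def)
  have nonempty: "\<exists>y. c y \<noteq> 0" if "c \<in> distr (carrier G)" for c :: "'g \<Rightarrow> 'r"
  proof (rule ccontr)
    assume "\<nexists>y. c y \<noteq> 0"
    with that have "(0::'r) = 1" by (simp add: distr_def)
    with one_neq_zero show False by simp
  qed
  have prod_one: "g \<otimes> h = \<one>" if "a g \<noteq> 0" "b h \<noteq> 0" for g h
  proof (rule ccontr)
    assume "g \<otimes> h \<noteq> \<one>"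
    \<comment> \<open>The convolution is evaluated at \<open>g \<otimes> h\<close>, where the delta
      distribution vanishes. Zero-sum-freeness kills each term of this sum, and integrality
      contradicts the choice of \<open>g\<close> and \<open>h\<close>.\<close>
    let ?A = "{(y1, y2). a y1 \<noteq> 0 \<and> b y2 \<noteq> 0 \<and> y1 \<otimes> y2 = g \<otimes> h}"
    have "finite ?A"
      by (rule finite_subset[OF _ finite_cartesian_product[OF fin]]) auto
    moreover have "(\<Sum>(y1, y2)\<in>?A. a y1 * b y2) = 0"
      using fun_cong[OF conv, of "g \<otimes> h"] \<open>g \<otimes> h \<noteq> \<one>\<close> by (simp add: delta_def)
    moreover have "(g, h) \<in> ?A" using that by simp
    ultimately have "(case (g, h) of (y1, y2) \<Rightarrow> a y1 * b y2) = 0"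
      by (rule sum_eq_0_zero_sum_free[OF zero_sum_free])
    then have "a g * b h = 0" by simp
    with integral that show False by blast
  qed
  obtain g where g: "a g \<noteq> 0" using nonempty[OF a] by blast
  obtain h where h: "b h \<noteq> 0" using nonempty[OF b] by blast
  \<comment> \<open>With \<open>h\<close> fixed, uniqueness of inverses collapses the support of
    \<open>a\<close> to one point.\<close>
  have "y = inv h" if "a y \<noteq> 0" for y
    using inv_equality[OF prod_one[OF that h] carr(2)[OF h] carr(1)[OF that]] by simp
  with g have "{y. a y \<noteq> 0} = {g}" by blast
  then have "a = delta g" by (rule distr_singleton[OF a])
  then show thesis using that carr(1)[OF g] by blast
qed

section \<open>Simplicial distributions with delta values\<close>

text \<open>This is \<phi> followed by the unit of the distribution monad, the map from
  \<open>Y\<close> to \<open>distr_sset Y\<close> sending y to its delta distribution. The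
  restriction to simplices matches the extensional representation in
  \<open>sset_maps\<close>.\<close>

definition dirac ::
    "('a, 'm) sset_scheme \<Rightarrow> (nat \<Rightarrow> 'a \<Rightarrow> 'b) \<Rightarrow>
     (nat \<Rightarrow> 'a \<Rightarrow> 'b \<Rightarrow> 'r::{comm_semiring_0,comm_monoid_mult})" where
  "dirac X \<phi> = (\<lambda>n. \<lambda>x\<in>simplices X n. delta (\<phi> n x))"

lemma simplicial_set_act_closed:
  assumes "simplicial_set X" "\<theta> \<in> simplex_maps m n" "x \<in> simplices X n"
  shows "act X m n \<theta> x \<in> simplices X m"
  using assms unfolding simplicial_set_def by blast

lemma sset_mapsD:
  assumes "\<phi> \<in> sset_maps X Y"
  shows "\<phi> n \<in> extensional (simplices X n)"
    and "x \<in> simplices X n \<Longrightarrow> \<phi> n x \<in> simplices Y n"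
    and "\<theta> \<in> simplex_maps m n \<Longrightarrow> x \<in> simplices X n \<Longrightarrow>
      \<phi> m (act X m n \<theta> x) = act Y m n \<theta> (\<phi> n x)"
  using assms by (auto simp: sset_maps_def PiE_iff)

text \<open>Pushing forward a delta distribution gives the delta at the image point, and deltas at
  distinct points differ when 1 \<noteq> 0, so the two naturality equations are equivalent. Only
  degreewise typing of \<phi> is assumed, so that simpliciality of \<phi> can be deduced from that
  of \<open>dirac X \<phi>\<close>.\<close>

lemma dirac_in_sset_maps_iff:
  assumes one_neq_zero: "(1::'r::{comm_semiring_0,comm_monoid_mult}) \<noteq> 0"
    and X: "simplicial_set X"
    and ext: "\<And>n. \<phi> n \<in> simplices X n \<rightarrow>\<^sub>E simplices Y n"
  shows "(dirac X \<phi> :: _ \<Rightarrow> _ \<Rightarrow> _ \<Rightarrow> 'r) \<in> sset_maps X (distr_sset Y) \<longleftrightarrow> \<phi> \<in> sset_maps X Y"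
proof -
  have "(dirac X \<phi> n :: _ \<Rightarrow> _ \<Rightarrow> 'r) \<in> simplices X n \<rightarrow>\<^sub>E simplices (distr_sset Y) n" for n
    using ext[of n] by (auto simp: dirac_def distr_sset_def intro!: delta_in_distr[OF one_neq_zero])
  moreover have "(dirac X \<phi> m (act X m n \<theta> x) :: _ \<Rightarrow> 'r)
        = act (distr_sset Y) m n \<theta> (dirac X \<phi> n x)
      \<longleftrightarrow> \<phi> m (act X m n \<theta> x) = act Y m n \<theta> (\<phi> n x)"
    if "\<theta> \<in> simplex_maps m n" "x \<in> simplices X n" for m n \<theta> x
    using that simplicial_set_act_closed[OF X that]
    by (simp add: dirac_def distr_sset_def distr_map_delta[OF one_neq_zero]
        delta_eq_iff[OF one_neq_zero])
  ultimately show ?thesis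
    using ext by (simp add: sset_maps_def)
qed

lemma dirac_in_carrier:
  assumes "(1::'r::{comm_semiring_0,comm_monoid_mult}) \<noteq> 0" "simplicial_set X" "\<phi> \<in> sset_maps X Y"
  shows "(dirac X \<phi> :: _ \<Rightarrow> _ \<Rightarrow> _ \<Rightarrow> 'r) \<in> carrier (distr_monoid X Y)"
  using assms dirac_in_sset_maps_iff[OF assms(1,2), of \<phi> Y]
  by (simp add: distr_monoid_def sset_maps_def)

lemma inj_on_dirac:
  assumes one_neq_zero: "(1::'r::{comm_semiring_0,comm_monoid_mult}) \<noteq> 0"
  shows "inj_on (dirac X :: _ \<Rightarrow> (_ \<Rightarrow> _ \<Rightarrow> _ \<Rightarrow> 'r)) (sset_maps X Y)"
proof (rule inj_onI)
  fix \<phi> \<psi>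
  assume \<phi>: "\<phi> \<in> sset_maps X Y" and \<psi>: "\<psi> \<in> sset_maps X Y"
    and eq: "(dirac X \<phi> :: _ \<Rightarrow> _ \<Rightarrow> _ \<Rightarrow> 'r) = dirac X \<psi>"
  have "\<phi> n x = \<psi> n x" if "x \<in> simplices X n" for n x
    using fun_cong[OF fun_cong[OF eq, of n], of x] that
    by (simp add: dirac_def delta_eq_iff[OF one_neq_zero])
  then show "\<phi> = \<psi>"
    using sset_mapsD(1)[OF \<phi>] sset_mapsD(1)[OF \<psi>] by (blast intro: extensionalityI)
qed

text \<open>The product of two one-point supports is a single pair, so the convolution sum has at
  most one term. The pointwise product on the right may be left unrestricted, since
  \<open>dirac\<close> discards values outside the simplices.\<close>

lemma dirac_mult:
  assumes one_neq_zero: "(1::'r::{comm_semiring_0,comm_monoid_mult}) \<noteq> 0"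
  shows "(dirac X \<phi> :: _ \<Rightarrow> _ \<Rightarrow> _ \<Rightarrow> 'r) \<otimes>\<^bsub>distr_monoid X Y\<^esub> dirac X \<psi>
    = dirac X (\<lambda>n x. \<phi> n x \<otimes>\<^bsub>degree_group Y n\<^esub> \<psi> n x)"
proof -
  have "{(y1, y2). (delta g y1 :: 'r) \<noteq> 0 \<and> (delta h y2 :: 'r) \<noteq> 0 \<and> y1 \<otimes>\<^bsub>G\<^esub> y2 = y}
      = (if y = g \<otimes>\<^bsub>G\<^esub> h then {(g, h)} else {})" for G :: "'b monoid" and g h y
    using one_neq_zero by (auto simp: delta_def)
  then have "(\<Sum>(y1, y2) | (delta g y1 :: 'r) \<noteq> 0 \<and> (delta h y2 :: 'r) \<noteq> 0 \<and> y1 \<otimes>\<^bsub>G\<^esub> y2 = y.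
      delta g y1 * delta h y2 :: 'r) = delta (g \<otimes>\<^bsub>G\<^esub> h) y" for G :: "'b monoid" and g h y
    by (simp add: delta_def)
  then show ?thesis
    by (auto simp: distr_monoid_def dirac_def fun_eq_iff)
qed

text \<open>The structure maps of \<open>Y\<close> are group homomorphisms and hence commute with
  inversion. This supplies the inverses of the delta-valued distributions.\<close>

lemma sset_maps_inverse:
  assumes X: "simplicial_set X" and Y: "simplicial_group Y" and \<phi>: "\<phi> \<in> sset_maps X Y"
  shows "(\<lambda>n. \<lambda>x\<in>simplices X n. inv\<^bsub>degree_group Y n\<^esub> \<phi> n x) \<in> sset_maps X Y"
proof -
  have carr: "carrier (degree_group Y n) = simplices Y n" for n
    by (simp add: degree_group_def)
  have grp: "group (degree_group Y n)" for n
    using Y by (simp add: simplicial_group_def)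
  have "inv\<^bsub>degree_group Y n\<^esub> \<phi> n x \<in> simplices Y n" if "x \<in> simplices X n" for n x
    using group.inv_closed[OF grp, of "\<phi> n x" n] sset_mapsD(2)[OF \<phi> that] by (simp add: carr)
  moreover have "inv\<^bsub>degree_group Y m\<^esub> \<phi> m (act X m n \<theta> x)
      = act Y m n \<theta> (inv\<^bsub>degree_group Y n\<^esub> \<phi> n x)"
    if "\<theta> \<in> simplex_maps m n" "x \<in> simplices X n" for m n \<theta> x
  proof -
    have "group_hom (degree_group Y n) (degree_group Y m) (act Y m n \<theta>)"
      using Y grp that by (simp add: simplicial_group_def group_hom_def group_hom_axioms_def)
    from group_hom.hom_inv[OF this, of "\<phi> n x"] show ?thesis
      using sset_mapsD(2)[OF \<phi> that(2)] sset_mapsD(3)[OF \<phi> that] by (simp add: carr)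
  qed
  ultimately show ?thesis
    using simplicial_set_act_closed[OF X] by (simp add: sset_maps_def)
qed

section \<open>The group of units\<close>

lemma Units_distr_monoid:
  fixes X :: "('a, 'm) sset_scheme" and Y :: "('b, 'n) sgroup_scheme"
  assumes zero_sum_free: "\<forall>a b :: 'r::{comm_semiring_0,comm_monoid_mult}.
      a + b = 0 \<longrightarrow> a = 0 \<and> b = 0"
    and integral: "\<forall>a b :: 'r. a * b = 0 \<longrightarrow> a = 0 \<or> b = 0"
    and one_neq_zero: "(1::'r) \<noteq> 0"
    and X: "simplicial_set X" and Y: "simplicial_group Y"
  shows "(Units (distr_monoid X Y) :: (nat \<Rightarrow> 'a \<Rightarrow> 'b \<Rightarrow> 'r) set) = dirac X ` sset_maps X Y"
    (is "Units ?M = _")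
proof (intro equalityI subsetI)
  have grp: "group (degree_group Y n)" for n
    using Y by (simp add: simplicial_group_def)
  have carr: "carrier (degree_group Y n) = simplices Y n" for n
    by (simp add: degree_group_def)
  {
    fix p assume "p \<in> Units ?M"
    then obtain q where p: "p \<in> sset_maps X (distr_sset Y)"
      and q: "q \<in> sset_maps X (distr_sset Y)" and pq: "p \<otimes>\<^bsub>?M\<^esub> q = \<one>\<^bsub>?M\<^esub>"
      by (auto simp: Units_def distr_monoid_def)
    have ex: "\<exists>g. g \<in> simplices Y n \<and> p n x = delta g" if x: "x \<in> simplices X n" for n x
    proof -
      have "p n x \<in> distr (carrier (degree_group Y n))" "q n x \<in> distr (carrier (degree_group Y n))"
        using sset_mapsD(2)[OF p x] sset_mapsD(2)[OF q x] by (simp_all add: distr_sset_def carr)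
      moreover have "(\<lambda>y. \<Sum>(y1, y2) | p n x y1 \<noteq> 0 \<and> q n x y2 \<noteq> 0 \<and>
          y1 \<otimes>\<^bsub>degree_group Y n\<^esub> y2 = y. p n x y1 * q n x y2) = delta \<one>\<^bsub>degree_group Y n\<^esub>"
        using fun_cong[OF fun_cong[OF pq, of n], of x] x by (simp add: distr_monoid_def)
      ultimately obtain g where "g \<in> carrier (degree_group Y n)" "p n x = delta g"
        by (rule convolution_eq_delta_one[OF zero_sum_free integral one_neq_zero grp])
      then show ?thesis using carr by blast
    qed
    \<comment> \<open>The points are chosen independently for each simplex, with no compatibility
      imposed. Compatibility of the restricted choice \<phi> is recovered from that of
      \<open>p\<close> through \<open>dirac_in_sset_maps_iff\<close>.\<close>
    define g where "g = (\<lambda>n x. SOME h. h \<in> simplices Y n \<and> p n x = delta h)"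
    have g: "g n x \<in> simplices Y n \<and> p n x = delta (g n x)" if "x \<in> simplices X n" for n x
      unfolding g_def by (rule someI_ex[OF ex[OF that]])
    define \<phi> where "\<phi> = (\<lambda>n. restrict (g n) (simplices X n))"
    have p_eq: "p = dirac X \<phi>"
      by (rule ext, rule extensionalityI[OF sset_mapsD(1)[OF p]])
        (simp_all add: g dirac_def \<phi>_def)
    moreover have "\<phi> n \<in> simplices X n \<rightarrow>\<^sub>E simplices Y n" for n
      using g by (simp add: \<phi>_def)
    ultimately have "\<phi> \<in> sset_maps X Y"
      using p dirac_in_sset_maps_iff[OF one_neq_zero X] by blast
    with p_eq show "p \<in> dirac X ` sset_maps X Y" by blast
  }
  {
    fix p :: "nat \<Rightarrow> 'a \<Rightarrow> 'b \<Rightarrow> 'r" assume "p \<in> dirac X ` sset_maps X Y"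
    then obtain \<phi> where \<phi>: "\<phi> \<in> sset_maps X Y" and p: "p = dirac X \<phi>" by blast
    define \<psi> where "\<psi> = (\<lambda>n. \<lambda>x\<in>simplices X n. inv\<^bsub>degree_group Y n\<^esub> \<phi> n x)"
    have \<psi>: "\<psi> \<in> sset_maps X Y"
      unfolding \<psi>_def by (rule sset_maps_inverse[OF X Y \<phi>])
    have "(dirac X \<phi> :: _ \<Rightarrow> _ \<Rightarrow> _ \<Rightarrow> 'r) \<otimes>\<^bsub>?M\<^esub> dirac X \<psi> = \<one>\<^bsub>?M\<^esub>"
      "(dirac X \<psi> :: _ \<Rightarrow> _ \<Rightarrow> _ \<Rightarrow> 'r) \<otimes>\<^bsub>?M\<^esub> dirac X \<phi> = \<one>\<^bsub>?M\<^esub>"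
      using sset_mapsD(2)[OF \<phi>] group.r_inv[OF grp] group.l_inv[OF grp]
      unfolding dirac_mult[OF one_neq_zero]
      by (auto simp: \<psi>_def distr_monoid_def dirac_def carr intro!: ext)
    then show "p \<in> Units ?M"
      using dirac_in_carrier[OF one_neq_zero X \<phi>] dirac_in_carrier[OF one_neq_zero X \<psi>]
      by (auto simp: Units_def p)
  }
qed

section \<open>Transport of distributions along an injection\<close>

text \<open>Since \<open>f\<close> is injective and its image contains the support of
  \<open>Q\<close>, it maps the support of the pullback bijectively onto that of \<open>Q\<close>;
  finiteness and total mass therefore agree. The equivalence serves both directions of the
  theorem.\<close>

lemma distr_pullback:
  fixes Q :: "'t \<Rightarrow> 'r::{comm_semiring_0,comm_monoid_mult}"
  assumes inj: "inj_on f S" and supp: "{t. Q t \<noteq> 0} \<subseteq> f ` S"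
  shows "(\<lambda>s. if s \<in> S then Q (f s) else 0) \<in> distr S \<longleftrightarrow> Q \<in> distr (f ` S)"
proof -
  let ?A = "{s \<in> S. Q (f s) \<noteq> 0}"
  have A: "{s. (if s \<in> S then Q (f s) else 0) \<noteq> 0} = ?A" by auto
  have im: "{t. Q t \<noteq> 0} = f ` ?A" using supp by auto
  have inj_A: "inj_on f ?A" using inj by (rule inj_on_subset) auto
  have "(\<Sum>s\<in>?A. if s \<in> S then Q (f s) else 0) = (\<Sum>t | Q t \<noteq> 0. Q t)"
    by (simp add: im sum.reindex[OF inj_A])
  moreover have "finite {t. Q t \<noteq> 0} \<longleftrightarrow> finite ?A"
    by (simp add: im finite_image_iff[OF inj_A])
  ultimately show ?thesis
    using supp by (auto simp: distr_def A)
qed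

text \<open>Evaluating \<open>dirac X \<phi>\<close> at a simplex gives exactly the delta
  distribution that \<phi> contributes to \<open>Theta\<close>. The two sums thus agree term by term
  after reindexing along the injective map \<open>dirac X\<close>.\<close>

lemma Theta_pullback:
  fixes Q :: "(nat \<Rightarrow> 'a \<Rightarrow> 'b \<Rightarrow> 'r) \<Rightarrow> 'r::{comm_semiring_0,comm_monoid_mult}"
  assumes one_neq_zero: "(1::'r) \<noteq> 0" and X: "simplicial_set X"
    and supp: "{t. Q t \<noteq> 0} \<subseteq> dirac X ` sset_maps X Y"
  shows "Theta X Y (\<lambda>\<phi>. if \<phi> \<in> sset_maps X Y then Q (dirac X \<phi>) else 0) = convex_eval X Y Q"
proof -
  let ?A = "{\<phi> \<in> sset_maps X Y. Q (dirac X \<phi>) \<noteq> 0}"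
  have inj_A: "inj_on (dirac X :: _ \<Rightarrow> (_ \<Rightarrow> _ \<Rightarrow> _ \<Rightarrow> 'r)) ?A"
    using inj_on_dirac[OF one_neq_zero] by (rule inj_on_subset) auto
  have A: "{\<phi>. \<phi> \<in> sset_maps X Y \<and> (if \<phi> \<in> sset_maps X Y then Q (dirac X \<phi>) else 0) \<noteq> 0} = ?A"
    by auto
  have im: "{p. p \<in> carrier (distr_monoid X Y) \<and> Q p \<noteq> 0} = dirac X ` ?A"
    using supp dirac_in_carrier[OF one_neq_zero X] by auto
  have "(\<Sum>\<phi>\<in>?A. (if \<phi> \<in> sset_maps X Y then Q (dirac X \<phi>) else 0) * delta (\<phi> n x) y)
      = (\<Sum>p\<in>dirac X ` ?A. Q p * p n x y)" if "x \<in> simplices X n" for n x y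
  proof -
    have "dirac X \<phi> n x = (delta (\<phi> n x) :: _ \<Rightarrow> 'r)" for \<phi> :: "nat \<Rightarrow> 'a \<Rightarrow> 'b"
      using that by (simp add: dirac_def)
    then show ?thesis by (simp add: sum.reindex[OF inj_A])
  qed
  then show ?thesis
    unfolding Theta_def convex_eval_def A im by (auto intro!: ext)
qed

theorem theorem1p2:
  fixes X :: "'a sset"
    and Y :: "'b sgroup"
    and p :: "nat \<Rightarrow> 'a \<Rightarrow> 'b \<Rightarrow> 'r::{comm_semiring_0,comm_monoid_mult}"
  assumes zero_sum_free: "\<And>a b :: 'r. a + b = 0 \<Longrightarrow> a = 0 \<and> b = 0"
    and integral: "\<And>a b :: 'r. a * b = 0 \<Longrightarrow> a = 0 \<or> b = 0"
    and X: "simplicial_set X"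
    and Y: "simplicial_group Y"
    and p: "p \<in> sset_maps X (distr_sset Y)"
  shows "noncontextual X Y p \<longleftrightarrow> weakly_invertible (distr_monoid X Y) (convex_eval X Y) p"
proof (cases "(1::'r) = 0")
  case True
  have eq: "a = b" for a b :: 'r
    using True by (metis mult_1 mult_zero_left)
  \<comment> \<open>All values in the semiring coincide, so extensional families of functions into
    it can no longer differ. Both maps therefore send the unique distribution to
    \<open>p\<close>.\<close>
  have "q = p" if "\<And>n. q n \<in> extensional (simplices X n)" for q
    by (rule ext, rule extensionalityI[OF that sset_mapsD(1)[OF p]], rule ext, rule eq)
  then have "Theta X Y (\<lambda>_. 0) = p" "convex_eval X Y (\<lambda>_. 0) = p"
    by (simp_all add: Theta_def convex_eval_def)
  then show ?thesis
    by (auto simp: noncontextual_def weakly_invertible_def distr_trivial[OF True])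
next
  case False
  let ?S = "sset_maps X Y"
  let ?D = "dirac X :: _ \<Rightarrow> (nat \<Rightarrow> 'a \<Rightarrow> 'b \<Rightarrow> 'r)"
  let ?pull = "\<lambda>Q \<phi>. if \<phi> \<in> ?S then Q (?D \<phi>) else (0::'r)"
  note inj = inj_on_dirac[OF False, of X Y]
  have Units: "Units (distr_monoid X Y) = ?D ` ?S"
    using zero_sum_free integral by (intro Units_distr_monoid[OF _ _ False X Y]) blast+
  show ?thesis
  proof
    assume "noncontextual X Y p"
    then obtain d where d: "d \<in> distr ?S" and p_eq: "p = Theta X Y d"
      by (auto simp: noncontextual_def)
    \<comment> \<open>\<open>Q\<close> is the pushforward of \<open>d\<close> along the injection
      \<open>?D\<close>. The default 0 confines its support to the units, and since \<open>d\<close>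
      itself vanishes off \<open>?S\<close>, pulling \<open>Q\<close> back returns \<open>d\<close>
      on the whole ambient type.\<close>
    define Q where "Q = (\<lambda>t. if t \<in> ?D ` ?S then d (the_inv_into ?S ?D t) else 0)"
    have supp: "{t. Q t \<noteq> 0} \<subseteq> ?D ` ?S" by (auto simp: Q_def)
    have d_eq: "d = ?pull Q"
      using d by (auto simp: Q_def distr_def fun_eq_iff the_inv_into_f_f[OF inj])
    have "Q \<in> distr (?D ` ?S)"
      using d unfolding d_eq distr_pullback[OF inj supp] .
    moreover have "p = convex_eval X Y Q"
      using p_eq unfolding d_eq Theta_pullback[OF False X supp] .
    ultimately show "weakly_invertible (distr_monoid X Y) (convex_eval X Y) p"
      by (simp add: weakly_invertible_def Units)
  next
    assume "weakly_invertible (distr_monoid X Y) (convex_eval X Y) p"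
    then obtain Q where Q: "Q \<in> distr (?D ` ?S)" and p_eq: "p = convex_eval X Y Q"
      by (auto simp: weakly_invertible_def Units)
    have supp: "{t. Q t \<noteq> 0} \<subseteq> ?D ` ?S" using Q by (simp add: distr_def)
    have "?pull Q \<in> distr ?S"
      using Q unfolding distr_pullback[OF inj supp] .
    moreover have "p = Theta X Y (?pull Q)"
      using p_eq unfolding Theta_pullback[OF False X supp] .
    ultimately show "noncontextual X Y p"
      by (auto simp: noncontextual_def)
  qed
qed

end
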